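(* For any diagram $D$ with $|G(D)|=0$, the ghost Kohnert poset $\mathcal{P}_G(D)$ is a join-semilattice, i.e. every pair of elements has a least upper bound.
   Context: A diagram is a finite set of cells placed at positions $(r,c)\in\mathbb{Z}_{>0}\times\mathbb{Z}_{>0}$ ($r$ the row, counted from the bottom; $c$ the column), each position holding at most one cell; each cell is either an ordinary cell, written $(r,c)$, or a ghost cell, written $\langle r,c\rangle$. A position is empty if it holds no cell of either kind. $G(D)$ denotes the set of ghost cells of $D$. The ghost move at row $r$ of $D$, with result denoted $\mathcal{G}(D,r)$, is defined as follows: if row $r$ is empty, $\mathcal{G}(D,r)=D$. Otherwise let $c$ be the largest column of a cell in row $r$. If this rightmost cell is a ghost cell, or there is no empty position $(\hat r,c)$ with $\hat r<r$, or, letting $\hat r<r$ be maximal with $(\hat r,c)$ empty, there is a ghost cell $\langle r^*,c\rangle$ with $\hat r<r^*<r$, then $\mathcal{G}(D,r)=D$. Otherwise, with $\hat r<r$ maximal such that $(\hat r,c)$ is empty, $\mathcal{G}(D,r)=(D\setminus\{(r,c)\})\cup\{(\hat r,c),\langle r,c\rangle\}$. $\mathrm{GKD}(D)$ is the set of all diagrams obtainable from $D$ by finite (possibly empty) sequences of ghost moves. The ghost Kohnert poset $\mathcal{P}_G(D)$ has underlying set $\mathrm{GKD}(D)$, with $D_2\preceq D_1$ iff $D_2$ can be obtained from $D_1$ by a finite (possibly empty) sequence of ghost moves. *)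

theory Defs
  imports "HOL-Algebra.Lattice"
begin

datatype cell = Ordinary (row: nat) (col: nat) | is_Ghost: Ghost (row: nat) (col: nat)

definition position :: "cell \<Rightarrow> nat \<times> nat" where
  "position x = (row x, col x)"

definition is_diagram :: "cell set \<Rightarrow> bool" where
  "is_diagram D \<longleftrightarrow> finite D \<and> (\<forall>x\<in>D. row x \<ge> 1 \<and> col x \<ge> 1) \<and> inj_on position D"

definition ghost_cells :: "cell set \<Rightarrow> cell set" where
  "ghost_cells D = {x \<in> D. is_Ghost x}"

definition row_empty :: "cell set \<Rightarrow> nat \<Rightarrow> bool" where
  "row_empty D r \<longleftrightarrow> (\<forall>x\<in>D. row x \<noteq> r)"

definition rightmost_col :: "cell set \<Rightarrow> nat \<Rightarrow> nat" where
  "rightmost_col D r = Max {c. (r, c) \<in> position ` D}"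

(* Rows start at 1, so row 0 never provides an empty position. *)
definition empty_rows_below :: "cell set \<Rightarrow> nat \<Rightarrow> nat \<Rightarrow> nat set" where
  "empty_rows_below D r c = {r'. 1 \<le> r' \<and> r' < r \<and> (r', c) \<notin> position ` D}"

definition ghost_move :: "cell set \<Rightarrow> nat \<Rightarrow> cell set" where
  "ghost_move D r =
    (if row_empty D r then D
     else let c = rightmost_col D r; E = empty_rows_below D r c; r' = Max E in
       if Ghost r c \<in> D \<or> E = {} \<or> (\<exists>s. r' < s \<and> s < r \<and> Ghost s c \<in> D) then D
       else (D - {Ordinary r c}) \<union> {Ordinary r' c, Ghost r c})"

definition ghost_reachable :: "cell set \<Rightarrow> cell set \<Rightarrow> bool" where
  "ghost_reachable = (\<lambda>D D'. \<exists>r\<ge>1. D' = ghost_move D r)\<^sup>*\<^sup>*"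

definition GKD :: "cell set \<Rightarrow> cell set set" where
  "GKD D = {D'. ghost_reachable D D'}"

definition ghost_kohnert_poset :: "cell set \<Rightarrow> cell set gorder" where
  "ghost_kohnert_poset D =
    \<lparr>carrier = GKD D, eq = (=), le = (\<lambda>D2 D1. ghost_reachable D1 D2)\<rparr>"

end

theory Submission
  imports Defs
begin

text \<open>
  A move at an ordinary cell leaves a ghost at that position forever, occupied positions stay
  occupied, and an ordinary cell that cannot move never regains that ability.  Hence if two
  different moves $a$, $b$ of $X$ both lead to a diagram $Z$, neither disables the other, they
  commute, and $Z$ can be reached from the diagram $W$ obtained by performing both: in a sequence of
  moves from $X$ to $Z$ the move $b$ can be shifted to the front.  The only obstructions to shifting
  it are a cell that crosses the position of $b$ in its column and a cell to the left of the landing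
  place of $b$ that moves before $b$ does; both are excluded because $Z$ is also reachable with $b$
  performed first.  For crossings this is a counting argument, since no cell crosses a ghost.

  As the diamond $X, X + a, X + b, W$ closes above every common descendant, an induction shows that
  any two common ancestors of $D_1$, $D_2$ lead to a third one.  The common ancestor with the
  largest number of ghosts is therefore the least upper bound.
\<close>

section \<open>Moves with explicit column and landing row\<close>

definition occupied :: "cell set \<Rightarrow> nat \<Rightarrow> nat \<Rightarrow> bool" where
  "occupied D r c \<longleftrightarrow> Ordinary r c \<in> D \<or> Ghost r c \<in> D"

text \<open>The column \<open>c\<close> and the landing row \<open>p\<close> are arguments, in place
  of the two maxima in \<open>ghost_move\<close>, and only moves that change the diagram are
  captured. A ghost at \<open>(r, c)\<close> is excluded explicitly because the sets of cells
  considered here need not satisfy \<open>is_diagram\<close>.\<close>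

definition movable :: "cell set \<Rightarrow> nat \<Rightarrow> nat \<Rightarrow> nat \<Rightarrow> bool" where
  "movable D r c p \<longleftrightarrow> Ordinary r c \<in> D \<and> Ghost r c \<notin> D \<and> (\<forall>c'>c. \<not> occupied D r c') \<and>
     1 \<le> p \<and> p < r \<and> \<not> occupied D p c \<and> (\<forall>s. p < s \<and> s < r \<longrightarrow> occupied D s c \<and> Ghost s c \<notin> D)"

definition drop_cell :: "cell set \<Rightarrow> nat \<Rightarrow> nat \<Rightarrow> nat \<Rightarrow> cell set" where
  "drop_cell D r c p = (D - {Ordinary r c}) \<union> {Ordinary p c, Ghost r c}"

definition ghost_step :: "cell set \<Rightarrow> cell set \<Rightarrow> bool" where
  "ghost_step D D' \<longleftrightarrow> (\<exists>r c p. movable D r c p \<and> D' = drop_cell D r c p)"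

lemma ghost_stepI: "movable D r c p \<Longrightarrow> ghost_step D (drop_cell D r c p)"
  unfolding ghost_step_def by blast

lemma Ghost_drop_cell:
  "Ghost s d \<in> drop_cell D r c p \<longleftrightarrow> Ghost s d \<in> D \<or> (s = r \<and> d = c)"
  by (auto simp: drop_cell_def)

lemma occupied_drop_cell:
  "movable D r c p \<Longrightarrow>
    occupied (drop_cell D r c p) s d \<longleftrightarrow> occupied D s d \<or> (s = p \<and> d = c)"
  by (auto simp: drop_cell_def occupied_def movable_def)

lemma Ordinary_drop_cell:
  "movable D r c p \<Longrightarrow>
    Ordinary s d \<in> drop_cell D r c p \<longleftrightarrow> (Ordinary s d \<in> D \<and> (s, d) \<noteq> (r, c)) \<or> (s = p \<and> d = c)"
  by (auto simp: drop_cell_def movable_def)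

lemma movable_unique:
  assumes "movable D r c p" "movable D r c q"
  shows "p = q"
  using assms unfolding movable_def by (metis linorder_neqE_nat)

lemma drop_cell_commute:
  assumes "movable D r c p" "movable D r' c' q" "(r, c) \<noteq> (r', c')"
  shows "drop_cell (drop_cell D r c p) r' c' q = drop_cell (drop_cell D r' c' q) r c p"
proof -
  \<comment> \<open>In \<open>D\<close> a source is occupied and a landing place is empty, so
    neither move removes the cell that the other one adds.\<close>
  have "Ordinary r' c' \<noteq> Ordinary p c" "Ordinary r c \<noteq> Ordinary q c'"
    using assms by (auto simp: movable_def occupied_def)
  then show ?thesis
    using assms(3) unfolding drop_cell_def by auto
qed

section \<open>Invariants and monotone quantities along sequences of moves\<close>

lemma reach_Ghost_mono:
  assumes "ghost_step\<^sup>*\<^sup>* D Z" "Ghost r c \<in> D"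
  shows "Ghost r c \<in> Z"
  using assms by (induction rule: rtranclp_induct) (auto simp: ghost_step_def Ghost_drop_cell)

lemma reach_occupied_mono:
  assumes "ghost_step\<^sup>*\<^sup>* D Z" "occupied D r c"
  shows "occupied Z r c"
  using assms by (induction rule: rtranclp_induct) (auto simp: ghost_step_def occupied_drop_cell)

text \<open>A new ghost arises only where the rightmost cell of a row moves, and the position to the
  right stays occupied.\<close>

lemma covered_cell_never_Ghost:
  assumes "ghost_step\<^sup>*\<^sup>* D Z" "occupied D r c'" "c < c'" "Ghost r c \<notin> D"
  shows "Ghost r c \<notin> Z"
  using assms
proof (induction rule: rtranclp_induct)
  case (step Y Z)
  have "occupied Y r c'"
    using reach_occupied_mono[OF step.hyps(1)] step.prems by blast
  with step show ?case
    by (auto simp: ghost_step_def Ghost_drop_cell movable_def)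
qed

text \<open>All rows from the ghost up to \<open>r\<close> stay occupied, so a cell at
  \<open>(r, c)\<close> could land only below the ghost, and no cell jumps over a ghost.\<close>

lemma blocked_cell_never_Ghost:
  assumes "ghost_step\<^sup>*\<^sup>* D Z" "Ghost s c \<in> D" "s < r"
    and "\<And>t. s < t \<Longrightarrow> t < r \<Longrightarrow> occupied D t c" "Ghost r c \<notin> D"
  shows "Ghost r c \<notin> Z"
  using assms(1)
proof (induction rule: rtranclp_induct)
  case base
  then show ?case using assms by simp
next
  case (step Y Z)
  have gh: "Ghost s c \<in> Y"
    using reach_Ghost_mono[OF step.hyps(1)] assms by blast
  have oc: "occupied Y t c" if "s \<le> t" "t < r" for t
    using reach_occupied_mono[OF step.hyps(1)] assms that gh
    by (metis le_neq_implies_less occupied_def)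
  have "\<not> movable Y r c p" for p
  proof
    assume m: "movable Y r c p"
    then have "\<not> s \<le> p" "p < r" using oc[of p] by (auto simp: movable_def)
    then show False using m gh assms(3) by (auto simp: movable_def)
  qed
  with step show ?case
    by (auto simp: ghost_step_def Ghost_drop_cell)
qed

text \<open>Along a move this changes only if a cell of column \<open>c\<close> crosses row \<open>r\<close>.\<close>

definition crossings :: "cell set \<Rightarrow> nat \<Rightarrow> nat \<Rightarrow> int" where
  "crossings D r c = int (card {s. s < r \<and> occupied D s c}) - int (card {s. s \<le> r \<and> Ghost s c \<in> D})"

text \<open>The landing place and the new ghost cancel if both are counted. Since ghosts are counted
  up to row \<open>r\<close> inclusive and occupied positions strictly below it, moves that start or
  land in row \<open>r\<close> contribute nothing.\<close>

lemma crossings_drop_cell: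
  assumes m: "movable D r' c' q"
  shows "crossings (drop_cell D r' c' q) r c =
    crossings D r c + (if c' = c \<and> q < r \<and> r < r' then 1 else 0)"
proof -
  have "{s. s < r \<and> occupied (drop_cell D r' c' q) s c} =
      (if c' = c \<and> q < r then insert q {s. s < r \<and> occupied D s c} else {s. s < r \<and> occupied D s c})"
    using m by (auto simp: occupied_drop_cell)
  moreover have "{s. s \<le> r \<and> Ghost s c \<in> drop_cell D r' c' q} =
      (if c' = c \<and> r' \<le> r then insert r' {s. s \<le> r \<and> Ghost s c \<in> D} else {s. s \<le> r \<and> Ghost s c \<in> D})"
    by (auto simp: Ghost_drop_cell)
  moreover have "q < r'" "\<not> occupied D q c'" "Ghost r' c' \<notin> D"
    using m by (auto simp: movable_def)
  ultimately show ?thesis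
    by (auto simp: crossings_def)
qed

lemma reach_crossings_mono:
  assumes "ghost_step\<^sup>*\<^sup>* D Z"
  shows "crossings D r c \<le> crossings Z r c"
  using assms
  by (induction rule: rtranclp_induct) (auto simp: ghost_step_def crossings_drop_cell)

text \<open>The ghost persists and would lie strictly between the source and the landing row of any
  crossing cell, which forbids that move.\<close>

lemma reach_crossings_Ghost:
  assumes "ghost_step\<^sup>*\<^sup>* D Z" "Ghost r c \<in> D"
  shows "crossings Z r c = crossings D r c"
  using assms
proof (induction rule: rtranclp_induct)
  case (step Y Z)
  have "Ghost r c \<in> Y"
    using reach_Ghost_mono[OF step.hyps(1)] step.prems .
  with step show ?case
    by (auto simp: ghost_step_def crossings_drop_cell movable_def)
qed simp

section \<open>Exchanging two moves\<close>

text \<open>Two moves interfere only if they share a landing place or if one lands in the row of the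
  other's cell, to the right of it. Reachability of \<open>Z\<close> excludes each case.\<close>

lemma movable_after_each_other:
  assumes b: "movable X r c p" and e: "movable X r' c' q" and ne: "(r, c) \<noteq> (r', c')"
    and Z: "ghost_step\<^sup>*\<^sup>* (drop_cell X r' c' q) Z" and bZ: "Ghost r c \<in> Z"
    and cr: "crossings (drop_cell X r' c' q) r c = crossings X r c"
    and left: "\<And>d. d < c \<Longrightarrow> Ghost p d \<in> Z \<Longrightarrow> Ghost p d \<in> X"
  shows "movable (drop_cell X r' c' q) r c p" "movable (drop_cell X r c p) r' c' q"
proof -
  let ?Y = "drop_cell X r' c' q"
  note occ = occupied_drop_cell[OF e] occupied_drop_cell[OF b]
  have nocross: "\<not> (c' = c \<and> q < r \<and> r < r')"
    using cr crossings_drop_cell[OF e, of r c] by (auto split: if_splits)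
  have bY: "Ghost r c \<notin> ?Y"
    using b ne by (auto simp: Ghost_drop_cell movable_def)
  \<comment> \<open>Otherwise the ghost left at \<open>(r', c)\<close> has only occupied positions
    between it and row \<open>r\<close>, so the cell at \<open>(r, c)\<close> could never move,
    contrary to \<open>bZ\<close>.\<close>
  have between: "\<not> (c' = c \<and> p < r' \<and> r' < r)"
  proof
    assume *: "c' = c \<and> p < r' \<and> r' < r"
    have "occupied ?Y t c" if "r' < t" "t < r" for t
    proof -
      have "occupied X t c" using b * that by (auto simp: movable_def)
      then show ?thesis by (simp add: occ)
    qed
    then have "Ghost r c \<notin> Z"
      using blocked_cell_never_Ghost[OF Z, of r' c r] * bY by (auto simp: Ghost_drop_cell)
    then show False using bZ by simp
  qed
  \<comment> \<open>With a common landing place one cell stands above the other in column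
    \<open>c\<close>, and both orders have just been excluded.\<close>
  have landing: "\<not> (q = p \<and> c' = c)"
    using nocross between b e ne by (auto simp: movable_def)
  have row_b: "\<not> (q = r \<and> c < c')"
    using covered_cell_never_Ghost[OF Z, of r c' c] bY bZ by (auto simp: occ)
  \<comment> \<open>Otherwise the ghost left at \<open>(r', c')\<close> would be a new one to the
    left of \<open>(p, c)\<close>, contrary to \<open>left\<close>.\<close>
  have row_e: "\<not> (p = r' \<and> c' < c)"
    using left[of c'] reach_Ghost_mono[OF Z, of r' c'] e
    by (auto simp: Ghost_drop_cell movable_def)
  show "movable ?Y r c p"
    using b bY ne landing row_b between
    unfolding movable_def occ Ordinary_drop_cell[OF e] Ghost_drop_cell by auto
  show "movable (drop_cell X r c p) r' c' q"
    using e ne landing row_e nocross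
    unfolding movable_def occ Ordinary_drop_cell[OF b] Ghost_drop_cell by auto
qed

text \<open>The move of \<open>(r, c)\<close> is pushed past each earlier move until it occurs
  itself. The condition on \<open>crossings\<close> is inherited because a monotone quantity with
  equal values at both ends is constant in between; the condition on ghosts is inherited because
  ghosts persist.\<close>

lemma reach_after_advanced_move:
  assumes "ghost_step\<^sup>*\<^sup>* X Z" and "movable X r c p" and "Ghost r c \<in> Z"
    and "crossings Z r c = crossings X r c"
    and "\<And>d. d < c \<Longrightarrow> Ghost p d \<in> Z \<Longrightarrow> Ghost p d \<in> X"
  shows "ghost_step\<^sup>*\<^sup>* (drop_cell X r c p) Z"
  using assms
proof (induction rule: converse_rtranclp_induct)
  case base
  then show ?case by (simp add: movable_def)
next
  case (step X Y)
  then obtain r' c' q where e: "movable X r' c' q" and Y: "Y = drop_cell X r' c' q"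
    by (auto simp: ghost_step_def)
  show ?case
  proof (cases "(r, c) = (r', c')")
    case True
    then show ?thesis
      using movable_unique e step.prems(1) step.hyps(2) Y by blast
  next
    case False
    have cr: "crossings Y r c = crossings X r c"
      using reach_crossings_mono[OF step.hyps(2), of r c] step.prems(3)
        crossings_drop_cell[OF e, of r c] Y by (auto split: if_splits)
    note m = movable_after_each_other[OF step.prems(1) e False step.hyps(2)[unfolded Y]
        step.prems(2) cr[unfolded Y] step.prems(4)]
    have "ghost_step\<^sup>*\<^sup>* (drop_cell Y r c p) Z"
      using step.IH[OF m(1)[folded Y]] step.prems cr by (auto simp: Y Ghost_drop_cell)
    moreover have "ghost_step (drop_cell X r c p) (drop_cell Y r c p)"
      using ghost_stepI[OF m(2)] drop_cell_commute[OF step.prems(1) e False] Y by simp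
    ultimately show ?thesis by simp
  qed
qed

text \<open>The path through the first move supplies what is needed to advance that move in the
  other path: its ghost at \<open>(r, c)\<close> freezes \<open>crossings\<close> there, and its
  landing place covers all positions to the left in row \<open>p\<close>.\<close>

lemma diamond:
  assumes b: "movable X r c p" and e: "movable X r' c' q" and ne: "(r, c) \<noteq> (r', c')"
    and bZ: "ghost_step\<^sup>*\<^sup>* (drop_cell X r c p) Z"
    and eZ: "ghost_step\<^sup>*\<^sup>* (drop_cell X r' c' q) Z"
  defines "W \<equiv> drop_cell (drop_cell X r' c' q) r c p"
  shows "ghost_step (drop_cell X r c p) W" "ghost_step (drop_cell X r' c' q) W"
    "ghost_step\<^sup>*\<^sup>* W Z"
proof -
  let ?Y = "drop_cell X r' c' q"
  have g: "Ghost r c \<in> Z"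
    using reach_Ghost_mono[OF bZ] by (simp add: Ghost_drop_cell)
  have crZ: "crossings Z r c = crossings X r c"
    using reach_crossings_Ghost[OF bZ, of r c] crossings_drop_cell[OF b, of r c]
    by (simp add: Ghost_drop_cell)
  have cr: "crossings ?Y r c = crossings X r c"
    using reach_crossings_mono[OF eZ, of r c] crZ crossings_drop_cell[OF e, of r c]
    by (auto split: if_splits)
  have left: "Ghost p d \<in> X" if "d < c" "Ghost p d \<in> Z" for d
    using covered_cell_never_Ghost[OF bZ, of p c d] that b
    by (auto simp: occupied_drop_cell Ghost_drop_cell movable_def)
  note m = movable_after_each_other[OF b e ne eZ g cr left]
  show "ghost_step (drop_cell X r c p) W"
    using ghost_stepI[OF m(2)] drop_cell_commute[OF b e ne] by (simp add: W_def)
  show "ghost_step ?Y W"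
    using ghost_stepI[OF m(1)] by (simp add: W_def)
  show "ghost_step\<^sup>*\<^sup>* W Z"
    unfolding W_def
    by (rule reach_after_advanced_move[OF eZ m(1) g])
      (use crZ cr left in \<open>auto simp: Ghost_drop_cell\<close>)
qed

section \<open>Ghost cells as a measure, and least common ancestors\<close>

lemma ghost_cells_drop_cell:
  "ghost_cells (drop_cell D r c p) = insert (Ghost r c) (ghost_cells D)"
  by (auto simp: ghost_cells_def drop_cell_def)

lemma reach_ghost_cells_mono:
  assumes "ghost_step\<^sup>*\<^sup>* D Z"
  shows "ghost_cells D \<subseteq> ghost_cells Z"
  using assms by (induction rule: rtranclp_induct) (auto simp: ghost_step_def ghost_cells_drop_cell)

lemma ghost_step_ghost_cells_psubset:
  assumes "ghost_step D Z"
  shows "ghost_cells D \<subset> ghost_cells Z"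
proof -
  obtain r c p where "movable D r c p" and Z: "Z = drop_cell D r c p"
    using assms by (auto simp: ghost_step_def)
  then have "Ghost r c \<notin> ghost_cells D" by (simp add: movable_def ghost_cells_def)
  then show ?thesis unfolding Z ghost_cells_drop_cell by blast
qed

lemma reach_same_ghost_cells:
  assumes "ghost_step\<^sup>*\<^sup>* D Z" "ghost_cells Z \<subseteq> ghost_cells D"
  shows "D = Z"
  using assms(1)
proof (cases rule: converse_rtranclpE)
  case (step Y)
  then show ?thesis
    using ghost_step_ghost_cells_psubset reach_ghost_cells_mono assms(2) by blast
qed

text \<open>Diamonds are pasted together as in Newman's lemma, by induction on the number of ghosts
  of \<open>D1\<close> that \<open>X\<close> still lacks.\<close>

lemma common_ancestors_directed:
  assumes fin: "finite (ghost_cells D1)"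
    and "ghost_step\<^sup>*\<^sup>* X U" "ghost_step\<^sup>*\<^sup>* X V"
    and "ghost_step\<^sup>*\<^sup>* U D1" "ghost_step\<^sup>*\<^sup>* U D2" "ghost_step\<^sup>*\<^sup>* V D1" "ghost_step\<^sup>*\<^sup>* V D2"
  shows "\<exists>W. ghost_step\<^sup>*\<^sup>* U W \<and> ghost_step\<^sup>*\<^sup>* V W \<and> ghost_step\<^sup>*\<^sup>* W D1 \<and> ghost_step\<^sup>*\<^sup>* W D2"
  using assms(2-)
proof (induction "card (ghost_cells D1 - ghost_cells X)" arbitrary: X U V rule: less_induct)
  case less
  show ?case
  proof (cases "X = U \<or> X = V")
    case True
    then show ?thesis using less.prems by blast
  next
    case False
    obtain A where A: "ghost_step X A" "ghost_step\<^sup>*\<^sup>* A U"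
      using less.prems(1) False by (metis converse_rtranclpE)
    obtain B where B: "ghost_step X B" "ghost_step\<^sup>*\<^sup>* B V"
      using less.prems(2) False by (metis converse_rtranclpE)
    have A12: "ghost_step\<^sup>*\<^sup>* A D1" "ghost_step\<^sup>*\<^sup>* A D2" and B12: "ghost_step\<^sup>*\<^sup>* B D1" "ghost_step\<^sup>*\<^sup>* B D2"
      using A(2) B(2) less.prems by (meson rtranclp_trans)+
    have decreasing: "card (ghost_cells D1 - ghost_cells Y) < card (ghost_cells D1 - ghost_cells X)"
      if "ghost_step X Y" "ghost_step\<^sup>*\<^sup>* Y D1" for Y
      using ghost_step_ghost_cells_psubset[OF that(1)] reach_ghost_cells_mono[OF that(2)] fin
      by (intro psubset_card_mono) auto
    obtain W where W: "ghost_step\<^sup>*\<^sup>* A W" "ghost_step\<^sup>*\<^sup>* B W" "ghost_step\<^sup>*\<^sup>* W D1" "ghost_step\<^sup>*\<^sup>* W D2"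
    proof -
      obtain r c p r' c' q where m: "movable X r' c' q" "A = drop_cell X r' c' q"
          "movable X r c p" "B = drop_cell X r c p"
        using A(1) B(1) unfolding ghost_step_def by blast
      show thesis
      proof (cases "(r, c) = (r', c')")
        case True
        then have "A = B" using m movable_unique by blast
        then show ?thesis using that A12 by blast
      next
        case False
        \<comment> \<open>The \<open>W\<close> of \<open>diamond\<close> does not depend on the
          common descendant, so one \<open>W\<close> reaches both \<open>D1\<close> and
          \<open>D2\<close>.\<close>
        note d = diamond[OF m(3,1) False, folded m(2,4)]
        show ?thesis
          using that d(1,2)[OF B12(1) A12(1)] d(3)[OF B12(1) A12(1)] d(3)[OF B12(2) A12(2)]
          by blast
      qed
    qed
    \<comment> \<open>The induction hypothesis at \<open>A\<close> joins \<open>U\<close> with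
      \<open>W\<close>; at \<open>B\<close> it then joins \<open>W1\<close> with
      \<open>V\<close>.\<close>
    obtain W1 where W1: "ghost_step\<^sup>*\<^sup>* U W1" "ghost_step\<^sup>*\<^sup>* W W1" "ghost_step\<^sup>*\<^sup>* W1 D1" "ghost_step\<^sup>*\<^sup>* W1 D2"
      using less.hyps[OF decreasing[OF A(1) A12(1)] A(2) W(1)] less.prems W by blast
    have "ghost_step\<^sup>*\<^sup>* B W1"
      using W(2) W1(2) by (rule rtranclp_trans)
    then obtain W2 where "ghost_step\<^sup>*\<^sup>* W1 W2" "ghost_step\<^sup>*\<^sup>* V W2" "ghost_step\<^sup>*\<^sup>* W2 D1" "ghost_step\<^sup>*\<^sup>* W2 D2"
      using less.hyps[OF decreasing[OF B(1) B12(1)] _ B(2), of W1] less.prems W1 by blast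
    then show ?thesis
      using W1(1) by (meson rtranclp_trans)
  qed
qed

lemma least_common_ancestor:
  assumes fin: "finite (ghost_cells D1)" and "ghost_step\<^sup>*\<^sup>* X D1" "ghost_step\<^sup>*\<^sup>* X D2"
  obtains U where "ghost_step\<^sup>*\<^sup>* X U" "ghost_step\<^sup>*\<^sup>* U D1" "ghost_step\<^sup>*\<^sup>* U D2"
    "\<And>V. ghost_step\<^sup>*\<^sup>* X V \<Longrightarrow> ghost_step\<^sup>*\<^sup>* V D1 \<Longrightarrow> ghost_step\<^sup>*\<^sup>* V D2 \<Longrightarrow> ghost_step\<^sup>*\<^sup>* V U"
proof -
  define P where "P U \<longleftrightarrow> ghost_step\<^sup>*\<^sup>* X U \<and> ghost_step\<^sup>*\<^sup>* U D1 \<and> ghost_step\<^sup>*\<^sup>* U D2" for U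
  have sub: "ghost_cells U \<subseteq> ghost_cells D1" if "P U" for U
    using that reach_ghost_cells_mono by (auto simp: P_def)
  have "P X" using assms by (simp add: P_def)
  \<comment> \<open>The ghosts of a common ancestor lie among those of \<open>D1\<close>, so their
    number is bounded; \<open>Suc\<close> makes the bound strict.\<close>
  then obtain U where U: "P U" and max: "\<And>V. P V \<Longrightarrow> card (ghost_cells V) \<le> card (ghost_cells U)"
    using ex_has_greatest_nat[of P X "\<lambda>V. card (ghost_cells V)" "Suc (card (ghost_cells D1))"]
      card_mono[OF fin sub] by (auto simp: less_Suc_eq_le)
  have "ghost_step\<^sup>*\<^sup>* V U" if "P V" for V
  proof -
    obtain W where W: "ghost_step\<^sup>*\<^sup>* U W" "ghost_step\<^sup>*\<^sup>* V W" "ghost_step\<^sup>*\<^sup>* W D1" "ghost_step\<^sup>*\<^sup>* W D2"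
      using common_ancestors_directed[OF fin, of X U V D2] U \<open>P V\<close> by (auto simp: P_def)
    have "P W" using U W by (auto simp: P_def)
    \<comment> \<open>By maximality of \<open>U\<close> the descendant \<open>W\<close> has no new
      ghosts, so both coincide and \<open>V\<close> reaches \<open>U\<close>.\<close>
    then have "ghost_cells U = ghost_cells W"
      using max reach_ghost_cells_mono[OF W(1)] sub finite_subset[OF _ fin] card_seteq by metis
    then show ?thesis
      using reach_same_ghost_cells[OF W(1)] W(2) by simp
  qed
  then show thesis using that U by (auto simp: P_def)
qed

section \<open>Translation between \<open>ghost_move\<close> and \<open>ghost_step\<close>\<close>

lemma position_image_iff: "(r, c) \<in> position ` D \<longleftrightarrow> occupied D r c"
proof
  assume "(r, c) \<in> position ` D"
  then obtain x where "x \<in> D" "r = row x" "c = col x" by (auto simp: position_def)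
  then show "occupied D r c" by (cases x) (auto simp: occupied_def)
next
  assume "occupied D r c"
  then show "(r, c) \<in> position ` D"
    unfolding occupied_def by (force simp: position_def image_iff)
qed

lemma row_empty_iff: "row_empty D r \<longleftrightarrow> (\<forall>c. \<not> occupied D r c)"
  unfolding row_empty_def position_image_iff[symmetric] by (auto simp: position_def)

lemma finite_row:
  assumes "finite D"
  shows "finite {c. occupied D r c}"
proof (rule finite_subset)
  show "{c. occupied D r c} \<subseteq> col ` D"
    by (force simp: occupied_def image_iff)
qed (use assms in simp)

lemma empty_rows_below_iff:
  "s \<in> empty_rows_below D r c \<longleftrightarrow> 1 \<le> s \<and> s < r \<and> \<not> occupied D s c"
  by (simp add: empty_rows_below_def position_image_iff)

lemma finite_empty_rows_below: "finite (empty_rows_below D r c)"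
  by (simp add: empty_rows_below_def)

text \<open>Finiteness of \<open>D\<close> ensures that \<open>rightmost_col\<close> is attained in
  a nonempty row.\<close>

lemma ghost_move_cases:
  assumes fin: "finite D"
  shows "ghost_move D r = D \<or> ghost_step D (ghost_move D r)"
proof (cases "ghost_move D r = D")
  case False
  define c where "c = rightmost_col D r"
  define E where "E = empty_rows_below D r c"
  define p where "p = Max E"
  have ne: "\<not> row_empty D r" and g: "Ghost r c \<notin> D" and E: "E \<noteq> {}"
    and ng: "\<And>s. p < s \<Longrightarrow> s < r \<Longrightarrow> Ghost s c \<notin> D" and res: "ghost_move D r = drop_cell D r c p"
    using False
    unfolding ghost_move_def drop_cell_def Let_def c_def[symmetric] E_def[symmetric] p_def[symmetric]
    by (auto split: if_splits)
  have c: "occupied D r c" "\<And>c'. c < c' \<Longrightarrow> \<not> occupied D r c'"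
    using Max_in[OF finite_row[OF fin, of r]] Max_ge[OF finite_row[OF fin, of r]] ne
    unfolding c_def rightmost_col_def position_image_iff row_empty_iff by (auto simp: not_le[symmetric])
  have "finite E" by (simp add: E_def finite_empty_rows_below)
  then have p: "p \<in> E" "\<And>s. s \<in> E \<Longrightarrow> s \<le> p"
    using Max_in E by (auto simp: p_def)
  have "occupied D s c" if "p < s" "s < r" for s
    using p(1) p(2)[of s] that by (auto simp: E_def empty_rows_below_iff)
  then have "movable D r c p"
    using p(1) c g ng
    by (auto simp: movable_def E_def empty_rows_below_iff occupied_def)
  then show ?thesis using ghost_stepI res by metis
qed simp

lemma ghost_move_movable:
  assumes "finite D" and m: "movable D r c p"
  shows "ghost_move D r = drop_cell D r c p"
proof -
  have oc: "occupied D r c" using m by (simp add: movable_def occupied_def)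
  have c: "rightmost_col D r = c"
    unfolding rightmost_col_def position_image_iff
    using m oc by (intro Max_eqI finite_row assms) (auto simp: movable_def not_le[symmetric])
  have pE: "p \<in> empty_rows_below D r c"
    using m by (auto simp: empty_rows_below_iff movable_def)
  have p: "Max (empty_rows_below D r c) = p"
    using m pE by (intro Max_eqI finite_empty_rows_below)
      (auto simp: empty_rows_below_iff movable_def not_le[symmetric])
  have "\<not> row_empty D r" using oc by (auto simp: row_empty_iff)
  then show ?thesis
    using m pE unfolding ghost_move_def Let_def c p drop_cell_def by (auto simp: movable_def)
qed

lemma reach_finite:
  assumes "ghost_step\<^sup>*\<^sup>* D D'" "finite D"
  shows "finite D'"
  using assms by (induction rule: rtranclp_induct) (auto simp: ghost_step_def drop_cell_def)

text \<open>Idle ghost moves drop out of a sequence, and finiteness, on which the translation of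
  single moves rests, is preserved.\<close>

lemma ghost_reachable_iff:
  assumes fin: "finite D"
  shows "ghost_reachable D D' \<longleftrightarrow> ghost_step\<^sup>*\<^sup>* D D'"
proof
  assume "ghost_reachable D D'"
  then show "ghost_step\<^sup>*\<^sup>* D D'"
    unfolding ghost_reachable_def
  proof (induction rule: rtranclp_induct)
    case (step Y Z)
    then show ?case
      using ghost_move_cases[OF reach_finite[OF step.IH fin]] by (metis rtranclp.rtrancl_into_rtrancl)
  qed simp
next
  assume "ghost_step\<^sup>*\<^sup>* D D'"
  then show "ghost_reachable D D'"
  proof (induction rule: rtranclp_induct)
    case base
    then show ?case by (simp add: ghost_reachable_def)
  next
    case (step Y Z)
    obtain r c p where m: "movable Y r c p" and Z: "Z = drop_cell Y r c p"
      using step.hyps(2) by (auto simp: ghost_step_def)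
    have "Z = ghost_move Y r" "1 \<le> r"
      using ghost_move_movable[OF reach_finite[OF step.hyps(1) fin] m] m Z by (auto simp: movable_def)
    then show ?case
      using step.IH unfolding ghost_reachable_def by (metis (mono_tags, lifting) rtranclp.rtrancl_into_rtrancl)
  qed
qed

section \<open>The join-semilattice\<close>

theorem theorem3p9:
  fixes D :: "cell set"
  assumes "is_diagram D" and "card (ghost_cells D) = 0"
  shows "upper_semilattice (ghost_kohnert_poset D)"
proof -
  let ?P = "ghost_kohnert_poset D"
  have fin: "finite D" using assms(1) by (simp add: is_diagram_def)
  have carrier: "A \<in> carrier ?P \<longleftrightarrow> ghost_step\<^sup>*\<^sup>* D A" for A
    by (simp add: ghost_kohnert_poset_def GKD_def ghost_reachable_iff[OF fin])
  have fin_carrier: "finite A" if "A \<in> carrier ?P" for A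
    using that reach_finite fin by (auto simp: carrier)
  have le: "B \<sqsubseteq>\<^bsub>?P\<^esub> A \<longleftrightarrow> ghost_step\<^sup>*\<^sup>* A B" if "A \<in> carrier ?P" for A B
    using ghost_reachable_iff[OF fin_carrier[OF that]] by (simp add: ghost_kohnert_poset_def)
  have eq: "(.=\<^bsub>?P\<^esub>) = (=)"
    by (simp add: ghost_kohnert_poset_def)
  interpret partial_order ?P
  proof
    fix A B
    assume AB: "A \<sqsubseteq>\<^bsub>?P\<^esub> B" "B \<sqsubseteq>\<^bsub>?P\<^esub> A" and "A \<in> carrier ?P" "B \<in> carrier ?P"
    then have "ghost_step\<^sup>*\<^sup>* A B" "ghost_step\<^sup>*\<^sup>* B A"
      using le by auto
    \<comment> \<open>Mutual reachability makes the sets of ghosts equal, and every actual move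
      would enlarge them.\<close>
    then show "A .=\<^bsub>?P\<^esub> B"
      using reach_same_ghost_cells reach_ghost_cells_mono by (simp add: eq)
  next
    fix A B C
    assume "A \<sqsubseteq>\<^bsub>?P\<^esub> B" "B \<sqsubseteq>\<^bsub>?P\<^esub> C" "A \<in> carrier ?P" "B \<in> carrier ?P" "C \<in> carrier ?P"
    then show "A \<sqsubseteq>\<^bsub>?P\<^esub> C"
      using le by (meson rtranclp_trans)
  qed (auto simp: eq le)
  show ?thesis
  proof
    fix D1 D2
    assume D12: "D1 \<in> carrier ?P" "D2 \<in> carrier ?P"
    then have "finite (ghost_cells D1)"
      using fin_carrier by (simp add: ghost_cells_def)
    then obtain U where U: "ghost_step\<^sup>*\<^sup>* D U" "ghost_step\<^sup>*\<^sup>* U D1" "ghost_step\<^sup>*\<^sup>* U D2"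
      "\<And>V. ghost_step\<^sup>*\<^sup>* D V \<Longrightarrow> ghost_step\<^sup>*\<^sup>* V D1 \<Longrightarrow> ghost_step\<^sup>*\<^sup>* V D2 \<Longrightarrow> ghost_step\<^sup>*\<^sup>* V U"
      using least_common_ancestor[of D1 D D2] D12 carrier by metis
    \<comment> \<open>The upper bounds of \<open>D1\<close> and \<open>D2\<close> are their common
      ancestors reachable from \<open>D\<close>.\<close>
    have "least ?P U (Upper ?P {D1, D2})"
      using U D12 by (intro least_UpperI) (auto simp: carrier le Upper_def)
    then show "\<exists>s. least ?P s (Upper ?P {D1, D2})" ..
  qed
qed

end
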